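(* Assume the following hypothesis holds: for every rational number $0<\theta\le 1$ there exists an integer $n_0=n_0(\theta)$ such that for all $n\ge n_0+1$, \[ R_n(\theta)=R_{n_0}(\theta)+R_{n-n_0}\bigl(\theta-R_{n_0}(\theta)\bigr), \] and the best $(n-n_0)$-term Egyptian underapproximation of $\theta-R_{n_0}(\theta)$ is always the one constructed by the greedy algorithm. Let $0<\lambda\le 1$ be a rational number whose best $m$-term Egyptian underapproximation is unique for every positive integer $m$. Let $\{u_n\}_{n=1}^\infty$ denote the best Egyptian underapproximation of $\lambda$, and let $a_1<a_2<\cdots$ be any other sequence of positive integers satisfying $\sum_{i=1}^\infty \frac{1}{a_i}=\lambda$. Then \[ \liminf_{n\to\infty} a_n^{1/2^n} < \lim_{n\to\infty} u_n^{1/2^n}. \]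
   Context: An $n$-term Egyptian underapproximation of a rational $0<\lambda\le1$ is a sequence of positive integers $x_1\le x_2\le\cdots\le x_n$ with $\sum_{i=1}^n 1/x_i<\lambda$. The best $n$-term Egyptian underapproximation is one maximizing $\sum_{i=1}^n 1/x_i$ (it exists), and $R_n(\lambda)$ denotes this maximal sum. The greedy $n$-term Egyptian underapproximation is defined recursively by $x_i=\lfloor(\lambda-\sum_{j<i}1/x_j)^{-1}\rfloor+1$. When the best $m$-term underapproximation is unique for all $m$, the best Egyptian underapproximation $\{u_n\}$ is the infinite sequence whose first $m$ terms form the best $m$-term Egyptian underapproximation for every $m$. *)

theory Defs
  imports Complex_Main "HOL-Library.Extended_Real"
begin

definition egyptian_sum :: "nat list \<Rightarrow> real" where
  "egyptian_sum xs = (\<Sum>x\<leftarrow>xs. 1 / real x)"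

definition underapprox :: "nat \<Rightarrow> real \<Rightarrow> nat list \<Rightarrow> bool" where
  "underapprox n \<theta> xs \<longleftrightarrow>
     length xs = n \<and> sorted xs \<and> (\<forall>x\<in>set xs. x > 0) \<and> egyptian_sum xs < \<theta>"

definition best_underapprox :: "nat \<Rightarrow> real \<Rightarrow> nat list \<Rightarrow> bool" where
  "best_underapprox n \<theta> xs \<longleftrightarrow>
     underapprox n \<theta> xs \<and> (\<forall>ys. underapprox n \<theta> ys \<longrightarrow> egyptian_sum ys \<le> egyptian_sum xs)"

(* The maximum is attained whenever \<theta> > 0; in particular R 0 \<theta> = 0. *)
definition R :: "nat \<Rightarrow> real \<Rightarrow> real" where
  "R n \<theta> = (GREATEST r. \<exists>xs. underapprox n \<theta> xs \<and> r = egyptian_sum xs)"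

primrec greedy_underapprox :: "nat \<Rightarrow> real \<Rightarrow> nat list" where
  "greedy_underapprox 0 \<theta> = []"
| "greedy_underapprox (Suc n) \<theta> =
     greedy_underapprox n \<theta> @
       [nat (\<lfloor>inverse (\<theta> - egyptian_sum (greedy_underapprox n \<theta>))\<rfloor> + 1)]"

(* Sequences are indexed from 0: the mathematical u_n is u (n - 1). Uniqueness of the best
   underapproximations does not by itself say that each one is a prefix of the next
   (for 11/24 they start [3], [4, 5]); that is part of being the sequence u. *)
definition best_underapprox_seq :: "real \<Rightarrow> (nat \<Rightarrow> nat) \<Rightarrow> bool" where
  "best_underapprox_seq \<theta> u \<longleftrightarrow> (\<forall>m\<ge>1. best_underapprox m \<theta> (map u [0..<m]))"

end

theory Submission imports Defs "HOL-Library.Multiset" begin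

text \<open>
  By the greedy hypothesis, \<open>\<theta> - R n \<theta>\<close> is eventually a unit fraction \<open>1 / w n\<close> with
  \<open>w (n + 1) = w n (w n + 1)\<close>, because the numerators of greedy remainders decrease. Hence
  \<open>u n = w n + 1\<close> eventually, and both \<open>w n\<close> and \<open>w n + 1\<close>, raised to the power \<open>1 / 2^(n+1)\<close>,
  converge monotonically to the limit \<open>c\<close>. Apply the same to the tail \<open>\<theta>\<close> of
  \<open>a\<close> after \<open>m\<close> terms, giving \<open>z n\<close>. If some \<open>z k < w (k + m)\<close>, the tails of \<open>a\<close> are too
  large for \<open>a\<close> to grow like \<open>c\<close> to the power \<open>2^(n+1)\<close>, so the lower limit is below \<open>c\<close>.
  Otherwise the first \<open>m\<close> terms of \<open>a\<close> extend to a best underapproximation of \<open>\<alpha>\<close>, which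
  by uniqueness consists of terms of \<open>u\<close>. If this happens for every \<open>m\<close>, then \<open>u \<le> a\<close>
  termwise, and comparing the sums yields \<open>a = u\<close>.
\<close>

section \<open>Egyptian sums and the existence of best underapproximations\<close>

lemma egyptian_sum_append: "egyptian_sum (xs @ ys) = egyptian_sum xs + egyptian_sum ys"
  by (simp add: egyptian_sum_def)

lemma egyptian_sum_sort [simp]: "egyptian_sum (sort xs) = egyptian_sum xs"
proof -
  have "mset (map (\<lambda>x. 1 / real x) (sort xs)) = mset (map (\<lambda>x. 1 / real x) xs)"
    by simp
  then show ?thesis
    unfolding egyptian_sum_def by (metis sum_mset_sum_list)
qed

lemma egyptian_sum_map_upt: "egyptian_sum (map f [m..<n]) = (\<Sum>i=m..<n. 1 / real (f i))"
  by (simp add: egyptian_sum_def o_def interv_sum_list_conv_sum_set_nat)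

lemma egyptian_sum_in_Rats: "egyptian_sum xs \<in> \<rat>"
  by (induction xs) (auto simp: egyptian_sum_def)

lemma underapprox_sort:
  assumes "\<forall>x\<in>set xs. x > 0" and "egyptian_sum xs < \<theta>"
  shows "underapprox (length xs) \<theta> (sort xs)"
  using assms by (simp add: underapprox_def)

lemma underapprox_exists:
  assumes "\<theta> > 0"
  shows "\<exists>xs. underapprox n \<theta> xs"
proof -
  obtain N :: nat where N: "real n / \<theta> < real N"
    using reals_Archimedean2 by blast
  then have "N > 0" using assms
    by (metis divide_nonneg_pos gr0I not_less of_nat_0 of_nat_0_le_iff)
  have "real n * (1 / real N) < \<theta>"
    using N assms \<open>N > 0\<close> by (simp add: field_simps)
  then have "underapprox n \<theta> (replicate n N)"
    using \<open>N > 0\<close> by (simp add: underapprox_def egyptian_sum_def sum_list_replicate)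
  then show ?thesis ..
qed

lemma egyptian_sum_le_length:
  assumes "sorted (x # xs)" and "x > 0"
  shows "egyptian_sum (x # xs) \<le> real (length (x # xs)) / real x"
proof -
  have "1 / real y \<le> 1 / real x" if "y \<in> set (x # xs)" for y
    using that assms by (intro divide_left_mono) (auto intro: mult_pos_pos)
  then have "egyptian_sum (x # xs) \<le> (\<Sum>y\<leftarrow>x # xs. 1 / real x)"
    unfolding egyptian_sum_def by (intro sum_list_mono)
  then show ?thesis
    by (simp add: sum_list_triv add_divide_distrib)
qed

text \<open>A competitor that is at least as good as a fixed underapproximation of sum \<open>g\<close> has
  smallest denominator at most \<open>n / g\<close>, so only finitely many smallest denominators matter.\<close>

lemma best_underapprox_exists:
  assumes "\<theta> > 0"
  shows "\<exists>xs. best_underapprox n \<theta> xs"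
  using assms
proof (induction n arbitrary: \<theta>)
  case 0
  then show ?case
    by (intro exI[of _ "[]"]) (auto simp: best_underapprox_def underapprox_def egyptian_sum_def)
next
  case (Suc n)
  obtain xs0 where xs0: "underapprox (Suc n) \<theta> xs0"
    using underapprox_exists[OF Suc.prems] by blast
  define g where "g = egyptian_sum xs0"
  obtain y0 ys0 where ys0: "xs0 = y0 # ys0"
    using xs0 by (cases xs0) (auto simp: underapprox_def)
  have "y0 > 0" using xs0 ys0 by (auto simp: underapprox_def)
  have "egyptian_sum ys0 \<ge> 0" by (auto simp: egyptian_sum_def intro!: sum_list_nonneg)
  then have "g > 0"
    using \<open>y0 > 0\<close> by (simp add: g_def ys0 egyptian_sum_def add_pos_nonneg)
  define X where "X = {x::nat. 0 < x \<and> 1 / real x < \<theta> \<and> real x \<le> real (Suc n) / g}"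
  have "X \<subseteq> {..nat \<lfloor>real (Suc n) / g\<rfloor>}"
    by (auto simp: X_def le_nat_floor)
  then have "finite X" by (rule finite_subset) simp
  define b where "b x = (SOME ys. best_underapprox n (\<theta> - 1 / real x) ys)" for x
  have b: "best_underapprox n (\<theta> - 1 / real x) (b x)" if "x \<in> X" for x
    unfolding b_def by (rule someI_ex) (use that in \<open>auto simp: X_def intro!: Suc.IH\<close>)
  define h where "h x = egyptian_sum (x # b x)" for x
  have better: "\<exists>x\<in>X. egyptian_sum ys \<le> h x"
    if ys: "underapprox (Suc n) \<theta> ys" and ge: "g \<le> egyptian_sum ys" for ys
  proof -
    obtain x zs where xz: "ys = x # zs"
      using ys by (cases ys) (auto simp: underapprox_def)
    have "x > 0" and sorted: "sorted (x # zs)" and len: "length zs = n"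
      and lt: "1 / real x + egyptian_sum zs < \<theta>"
      using ys xz by (auto simp: underapprox_def egyptian_sum_def)
    have nonneg: "egyptian_sum zs \<ge> 0"
      by (auto simp: egyptian_sum_def intro!: sum_list_nonneg)
    have "g \<le> real (Suc n) / real x"
      using egyptian_sum_le_length[OF sorted \<open>x > 0\<close>] ge xz len by simp
    then have "real x \<le> real (Suc n) / g"
      using \<open>x > 0\<close> \<open>g > 0\<close> by (simp add: field_simps)
    then have "x \<in> X" using \<open>x > 0\<close> lt nonneg by (simp add: X_def)
    have "underapprox n (\<theta> - 1 / real x) zs"
      using ys xz lt by (auto simp: underapprox_def)
    then have "egyptian_sum zs \<le> egyptian_sum (b x)"
      using b[OF \<open>x \<in> X\<close>] by (auto simp: best_underapprox_def)
    then have "egyptian_sum ys \<le> h x" by (simp add: xz h_def egyptian_sum_def)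
    with \<open>x \<in> X\<close> show ?thesis by blast
  qed
  from better[OF xs0] have "X \<noteq> {}" by (auto simp: g_def)
  then have fin: "finite (h ` X)" "h ` X \<noteq> {}" using \<open>finite X\<close> by auto
  then have "Max (h ` X) \<in> h ` X" by (rule Max_in)
  then obtain x where x: "x \<in> X" "Max (h ` X) = h x" by auto
  \<comment> \<open>The completion \<open>b x\<close> is optimal among all \<open>n\<close>-term
    lists, so it may contain entries below \<open>x\<close>; the list is sorted to become an
    admissible competitor with the same sum.\<close>
  have under: "underapprox (Suc n) \<theta> (sort (x # b x))"
    using b[OF x(1)] x(1) underapprox_sort[of "x # b x" \<theta>]
    by (auto simp: best_underapprox_def underapprox_def X_def egyptian_sum_def simp del: sort_key_simps)
  have max: "egyptian_sum ys \<le> h x" if "underapprox (Suc n) \<theta> ys" for ys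
  proof (cases "g \<le> egyptian_sum ys")
    case True
    then show ?thesis using better[OF that] x(2) fin(1)
      by (metis Max_ge image_eqI order_trans)
  next
    case False
    then show ?thesis using better[OF xs0] x(2) fin(1)
      by (metis Max_ge g_def image_eqI linear order_trans)
  qed
  have "egyptian_sum (sort (x # b x)) = h x"
    by (simp only: egyptian_sum_sort h_def)
  then have "best_underapprox (Suc n) \<theta> (sort (x # b x))"
    using under max unfolding best_underapprox_def by metis
  then show ?case ..
qed

section \<open>The maximal sum \<open>R\<close> and the Sylvester recursion for its
  remainders\<close>

lemma R_eqI:
  assumes "best_underapprox n \<theta> xs"
  shows "R n \<theta> = egyptian_sum xs"
  unfolding R_def using assms
  by (intro Greatest_equality) (auto simp: best_underapprox_def)

lemma R_attained:
  assumes "\<theta> > 0"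
  obtains xs where "underapprox n \<theta> xs" and "egyptian_sum xs = R n \<theta>"
  using best_underapprox_exists[OF assms, of n] R_eqI[of n \<theta>]
  by (auto simp: best_underapprox_def)

lemma R_upper:
  assumes "\<theta> > 0" and "underapprox n \<theta> xs"
  shows "egyptian_sum xs \<le> R n \<theta>"
  using best_underapprox_exists[OF assms(1), of n] R_eqI[of n \<theta>] assms(2)
  by (auto simp: best_underapprox_def)

text \<open>The numerators of the remainders, written without reduction, strictly decrease until the
  numerator divides the denominator.\<close>

lemma greedy_remainder_reaches_unit_fraction:
  fixes G :: "nat \<Rightarrow> real"
  assumes step: "\<And>k. G (Suc k) = G k - 1 / real (nat (\<lfloor>inverse (G k)\<rfloor> + 1))"
    and "G k = real p / real q" and "p > 0" and "q > 0"
  shows "\<exists>j w. w > 0 \<and> G j = 1 / real w"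
  using assms(2-4)
proof (induction p arbitrary: k q rule: less_induct)
  case (less p)
  show ?case
  proof (cases "p dvd q")
    case True
    then obtain w where "q = p * w" by blast
    then have "w > 0" "G k = 1 / real w" using less.prems by auto
    then show ?thesis by blast
  next
    case False
    define x where "x = q div p + 1"
    \<comment> \<open>Subtracting the greedy term gives \<open>p/q - 1/x = (p x - q)/(q x)\<close>,
      and \<open>p'\<close> is this new numerator \<open>p x - q\<close>. It is positive and below
      \<open>p\<close> because \<open>p\<close> does not divide \<open>q\<close>.\<close>
    define p' where "p' = p - q mod p"
    have "q mod p > 0" using False by (auto simp: dvd_eq_mod_eq_0)
    moreover have "q mod p < p" using less.prems by simp
    ultimately have p': "p' < p" "p' > 0" by (auto simp: p'_def)
    have "p * x = q + p'"
    proof -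
      have "p * x = p * (q div p) + p" by (simp add: x_def)
      also have "\<dots> = p * (q div p) + q mod p + p'"
        using \<open>q mod p < p\<close> unfolding p'_def by linarith
      finally show ?thesis by simp
    qed
    then have px: "real p * real x = real q + real p'"
      by (metis of_nat_add of_nat_mult)
    have "\<lfloor>inverse (G k)\<rfloor> = int (q div p)"
      using less.prems(1) floor_divide_of_nat_eq[of q p, where ?'a = real] by simp
    then have "nat (\<lfloor>inverse (G k)\<rfloor> + 1) = x" by (simp add: x_def)
    then have "G (Suc k) = real p / real q - 1 / real x"
      using step[of k] less.prems(1) by simp
    also have "\<dots> = real p' / real (q * x)"
      using px less.prems(3) by (simp add: x_def field_simps)
    finally show ?thesis
      using less.IH[OF p'(1), of "Suc k" "q * x"] p'(2) less.prems(3) by (simp add: x_def)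
  qed
qed

text \<open>From a remainder \<open>1/v\<close> the greedy choice is \<open>v + 1\<close>, and
  \<open>1/v - 1/(v + 1) = 1/(v (v + 1))\<close>. So once a unit fraction is reached, every later
  remainder is one too.\<close>

lemma greedy_remainder_eventually_Sylvester:
  fixes G :: "nat \<Rightarrow> real"
  assumes step: "\<And>k. G (Suc k) = G k - 1 / real (nat (\<lfloor>inverse (G k)\<rfloor> + 1))"
    and "G 0 \<in> \<rat>" and "G 0 > 0"
  shows "\<exists>N w. \<forall>n\<ge>N. w n > (0::nat) \<and> G n = 1 / real (w n) \<and> w (Suc n) = w n * (w n + 1)"
proof -
  obtain p q :: nat where "q \<noteq> 0" and "\<bar>G 0\<bar> = real p / real q"
    using Rats_abs_nat_div_natE[OF assms(2)] by metis
  with assms(3) have pq: "G 0 = real p / real q" "p > 0" "q > 0"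
    by (auto intro!: gr0I)
  obtain N w where N: "w > 0" "G N = 1 / real w"
    using greedy_remainder_reaches_unit_fraction[OF step pq] by blast
  have next_w: "G (Suc k) = 1 / real (v * (v + 1))" if "v > 0" "G k = 1 / real v" for k v :: nat
  proof -
    have "nat (\<lfloor>inverse (G k)\<rfloor> + 1) = v + 1" using that(2) by (simp add: nat_add_distrib)
    then have "G (Suc k) = 1 / real v - 1 / real (v + 1)" using step[of k] that(2) by simp
    also have "\<dots> = 1 / real (v * (v + 1))" using that(1) by (simp add: field_simps)
    finally show ?thesis .
  qed
  define f where "f n = ((\<lambda>v. v * (v + 1)) ^^ (n - N)) w" for n
  have f_Suc: "f (Suc n) = f n * (f n + 1)" if "n \<ge> N" for n
    using that by (simp add: f_def Suc_diff_le)
  have "f n > 0 \<and> G n = 1 / real (f n)" if "n \<ge> N" for n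
    using that
  proof (induction n rule: dec_induct)
    case base
    then show ?case using N by (simp add: f_def)
  next
    case (step n)
    then show ?case using next_w[of "f n" n] f_Suc[of n] by simp
  qed
  then show ?thesis using f_Suc by blast
qed

text \<open>Beyond \<open>n0\<close>, the remainder of \<open>\<theta>\<close> after
  \<open>n\<close> optimal terms is the greedy remainder of \<open>\<sigma>\<close> after
  \<open>n - n0\<close> terms. Since \<open>\<sigma>\<close> is rational and positive, the greedy
  recursion applies after this index shift.\<close>

lemma R_remainder_eventually_Sylvester:
  assumes \<theta>: "\<theta> \<in> \<rat>" "\<theta> > 0"
    and greedy: "\<And>n. n \<ge> n0 + 1 \<Longrightarrow> R n \<theta> = R n0 \<theta> + R (n - n0) (\<theta> - R n0 \<theta>)"
      "\<And>n. n \<ge> n0 + 1 \<Longrightarrow> best_underapprox (n - n0) (\<theta> - R n0 \<theta>)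
            (greedy_underapprox (n - n0) (\<theta> - R n0 \<theta>))"
  shows "\<exists>N w. \<forall>n\<ge>N. w n > (0::nat) \<and> \<theta> - R n \<theta> = 1 / real (w n) \<and> w (Suc n) = w n * (w n + 1)"
proof -
  define \<sigma> where "\<sigma> = \<theta> - R n0 \<theta>"
  define G where "G k = \<sigma> - egyptian_sum (greedy_underapprox k \<sigma>)" for k
  obtain xs where xs: "underapprox n0 \<theta> xs" "egyptian_sum xs = R n0 \<theta>"
    using R_attained[OF \<theta>(2)] .
  have G0: "G 0 = \<sigma>" by (simp add: G_def egyptian_sum_def)
  have "\<sigma> \<in> \<rat>" using \<theta>(1) egyptian_sum_in_Rats[of xs] xs(2) by (simp add: \<sigma>_def)
  moreover have "\<sigma> > 0" using xs by (simp add: \<sigma>_def underapprox_def)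
  moreover have "G (Suc k) = G k - 1 / real (nat (\<lfloor>inverse (G k)\<rfloor> + 1))" for k
    by (simp add: G_def egyptian_sum_append) (simp add: egyptian_sum_def)
  ultimately obtain N w where N: "\<And>n. n \<ge> N \<Longrightarrow>
      w n > (0::nat) \<and> G n = 1 / real (w n) \<and> w (Suc n) = w n * (w n + 1)"
    using greedy_remainder_eventually_Sylvester[of G] G0 by metis
  have rem: "\<theta> - R (n0 + k) \<theta> = G k" if "k \<ge> 1" for k
    using greedy(1)[of "n0 + k"] R_eqI[OF greedy(2)[of "n0 + k"]] that
    by (simp add: G_def \<sigma>_def)
  have "w (n - n0) > 0 \<and> \<theta> - R n \<theta> = 1 / real (w (n - n0)) \<and>
      w (Suc n - n0) = w (n - n0) * (w (n - n0) + 1)" if "n \<ge> n0 + N + 1" for n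
    using N[of "n - n0"] rem[of "n - n0"] that by (simp add: Suc_diff_le)
  then show ?thesis
    by (intro exI[of _ "n0 + N + 1"] exI[of _ "\<lambda>n. w (n - n0)"]) blast
qed

section \<open>Roots along the recursion \<open>w (n + 1) = w n (w n + 1)\<close>\<close>

lemma powr_inverse_two_power_Suc:
  fixes x :: real
  assumes "x > 0"
  shows "x powr (1 / 2 ^ n) = (x ^ 2) powr (1 / 2 ^ Suc n)"
proof -
  have "(x ^ 2) powr (1 / 2 ^ Suc n) = (x powr 2) powr (1 / 2 ^ Suc n)"
    using assms by simp
  also have "\<dots> = x powr (2 * (1 / 2 ^ Suc n))" by (rule powr_powr)
  finally show ?thesis by simp
qed

text \<open>One step suffices: \<open>w (w + 1) + 1 \<le> (w + 1)^2\<close>, and squaring is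
  absorbed by doubling the order of the root.\<close>

lemma Sylvester_upper_root_le:
  fixes w :: "nat \<Rightarrow> nat"
  assumes rec: "\<And>n. n \<ge> N \<Longrightarrow> w (Suc n) = w n * (w n + 1)" and "N \<le> m" and "m \<le> n"
  shows "real (w n + 1) powr (1 / 2 ^ Suc n) \<le> real (w m + 1) powr (1 / 2 ^ Suc m)"
  using assms(3)
proof (induction n rule: dec_induct)
  case (step n)
  have "real (w (Suc n) + 1) \<le> real (w n + 1) ^ 2"
    using rec[of n] step assms(2) by (simp add: power2_eq_square algebra_simps)
  then have "real (w (Suc n) + 1) powr (1 / 2 ^ Suc (Suc n))
      \<le> (real (w n + 1) ^ 2) powr (1 / 2 ^ Suc (Suc n))"
    by (intro powr_mono2) auto
  also have "\<dots> = real (w n + 1) powr (1 / 2 ^ Suc n)"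
    by (rule powr_inverse_two_power_Suc[symmetric]) simp
  finally show ?case using step by simp
qed simp

text \<open>The counterpart from below, resting on \<open>w^2 \<le> w (w + 1)\<close>.\<close>

lemma Sylvester_lower_root_le:
  fixes w :: "nat \<Rightarrow> nat"
  assumes rec: "\<And>n. n \<ge> N \<Longrightarrow> w (Suc n) = w n * (w n + 1)"
    and pos: "\<And>n. n \<ge> N \<Longrightarrow> w n > 0" and "N \<le> m" and "m \<le> n"
  shows "real (w m) powr (1 / 2 ^ Suc m) \<le> real (w n) powr (1 / 2 ^ Suc n)"
  using assms(4)
proof (induction n rule: dec_induct)
  case (step n)
  have "real (w n) powr (1 / 2 ^ Suc n) = (real (w n) ^ 2) powr (1 / 2 ^ Suc (Suc n))"
    using pos[of n] step assms(3) by (intro powr_inverse_two_power_Suc) simp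
  also have "\<dots> \<le> real (w (Suc n)) powr (1 / 2 ^ Suc (Suc n))"
    using rec[of n] step assms(3) by (intro powr_mono2) (auto simp: power2_eq_square algebra_simps)
  finally show ?case using step by simp
qed simp

text \<open>The upper roots decrease and are nonnegative, so they converge. The lower roots increase
  and lie below the upper roots of the same index, hence none exceeds the limit.\<close>

lemma Sylvester_root_limit:
  fixes w :: "nat \<Rightarrow> nat"
  assumes rec: "\<And>n. n \<ge> N \<Longrightarrow> w (Suc n) = w n * (w n + 1)"
    and pos: "\<And>n. n \<ge> N \<Longrightarrow> w n > 0"
  obtains c where "(\<lambda>n. real (w n + 1) powr (1 / 2 ^ Suc n)) \<longlonglongrightarrow> c"
    and "\<And>m. m \<ge> N \<Longrightarrow> real (w m) powr (1 / 2 ^ Suc m) \<le> c"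
proof -
  define x where "x n = real (w n + 1) powr (1 / 2 ^ Suc n)" for n
  have "decseq (\<lambda>n. x (n + N))"
    unfolding x_def by (rule decseq_SucI, rule Sylvester_upper_root_le[where w = w and N = N, OF rec]) auto
  then obtain c where "(\<lambda>n. x (n + N)) \<longlonglongrightarrow> c"
    using decseq_convergent[of "\<lambda>n. x (n + N)" 0] by (auto simp: x_def)
  then have c: "x \<longlonglongrightarrow> c" by (simp add: LIMSEQ_offset)
  have "real (w m) powr (1 / 2 ^ Suc m) \<le> c" if "m \<ge> N" for m
  proof (rule LIMSEQ_le_const[OF c], intro exI allI impI)
    fix n assume "m \<le> n"
    then have "real (w m) powr (1 / 2 ^ Suc m) \<le> real (w n) powr (1 / 2 ^ Suc n)"
      by (intro Sylvester_lower_root_le[where w = w and N = N, OF rec pos that]) auto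
    also have "\<dots> \<le> x n" unfolding x_def by (intro powr_mono2) auto
    finally show "real (w m) powr (1 / 2 ^ Suc m) \<le> x n" .
  qed
  then show ?thesis using that c unfolding x_def by blast
qed

section \<open>Growth of a sequence against the size of its tails\<close>

text \<open>With \<open>x = 1 / E^(2^(j+1))\<close>, the term of index \<open>i + j\<close> is at
  most \<open>x^(2^i) \<le> x^(i+1)\<close>, so the tail is dominated by the geometric series of sum
  \<open>x / (1 - x)\<close>.\<close>

lemma doubly_exponential_tail_bound:
  fixes a :: "nat \<Rightarrow> nat" and E :: real
  assumes sums: "(\<lambda>n. 1 / real (a n)) sums s" and "E > 1"
    and ge: "\<And>i. i \<ge> j \<Longrightarrow> E ^ (2 ^ Suc i) \<le> real (a i)"
  shows "s - (\<Sum>i<j. 1 / real (a i)) \<le> 1 / (E ^ (2 ^ Suc j) - 1)"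
proof -
  define x where "x = 1 / E ^ (2 ^ Suc j)"
  have E: "E ^ (2 ^ Suc j) > 1" using \<open>E > 1\<close> by (intro one_less_power) auto
  have x: "0 < x" "x < 1" using E by (auto simp: x_def field_simps)
  have "1 / real (a (i + j)) \<le> x * x ^ i" for i
  proof -
    have "1 / real (a (i + j)) \<le> 1 / E ^ (2 ^ Suc (i + j))"
      using ge[of "i + j"] \<open>E > 1\<close> by (intro divide_left_mono) (auto intro!: mult_pos_pos
        intro: less_le_trans[of 0 "E ^ (2 ^ Suc (i + j))"])
    also have "\<dots> = x ^ (2 ^ i)"
      by (simp add: x_def power_one_over power_mult[symmetric] power_add ac_simps)
    also have "\<dots> \<le> x ^ Suc i"
      using x less_exp[of i] by (intro power_decreasing Suc_leI) auto
    finally show ?thesis by simp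
  qed
  moreover have "(\<lambda>i. 1 / real (a (i + j))) sums (s - (\<Sum>i<j. 1 / real (a i)))"
    using sums_iff_shift[of "\<lambda>n. 1 / real (a n)" j] sums by simp
  moreover have "(\<lambda>i. x * x ^ i) sums (x * (1 / (1 - x)))"
    using x by (intro sums_mult geometric_sums) auto
  ultimately have "s - (\<Sum>i<j. 1 / real (a i)) \<le> x * (1 / (1 - x))"
    by (rule sums_le)
  also have "\<dots> = 1 / (E ^ (2 ^ Suc j) - 1)"
    using E \<open>E > 1\<close> by (simp add: x_def field_simps)
  finally show ?thesis .
qed

text \<open>Write \<open>E = D (1 + d)\<close>. By Bernoulli the gap between the \<open>n\<close>-th
  powers is at least \<open>D^n n d\<close>, which exceeds 1 once \<open>n d > 1\<close>; here
  \<open>n = 2^(j+1) > j\<close>.\<close>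

lemma power_gap_unbounded:
  fixes D E :: real
  assumes "1 \<le> D" and "D < E"
  shows "\<exists>j0. \<forall>j\<ge>j0. D ^ (2 ^ Suc j) + 1 < E ^ (2 ^ Suc j)"
proof -
  define d where "d = E / D - 1"
  have "d > 0" using assms by (simp add: d_def field_simps)
  obtain j0 :: nat where j0: "1 / d < real j0" using reals_Archimedean2 by blast
  have "D ^ (2 ^ Suc j) + 1 < E ^ (2 ^ Suc j)" if "j \<ge> j0" for j
  proof -
    define n :: nat where "n = 2 ^ Suc j"
    have "j < n" using less_exp[of "Suc j"] by (simp add: n_def)
    then have "1 / d < real n" using j0 that by linarith
    then have "1 < real n * d" using \<open>d > 0\<close> by (simp add: field_simps)
    have "D ^ n + 1 < D ^ n + D ^ n * (real n * d)"
    proof -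
      have "1 * 1 \<le> D ^ n * 1" using assms by simp
      also have "\<dots> < D ^ n * (real n * d)"
        using \<open>1 < real n * d\<close> assms by (intro mult_strict_left_mono) auto
      finally show ?thesis by simp
    qed
    also have "\<dots> = D ^ n * (1 + real n * d)" by (simp add: algebra_simps)
    also have "\<dots> \<le> D ^ n * (1 + d) ^ n"
      using \<open>d > 0\<close> assms by (intro mult_left_mono Bernoulli_inequality) auto
    also have "\<dots> = E ^ n" using assms by (simp add: d_def power_divide)
    finally show ?thesis by (simp add: n_def)
  qed
  then show ?thesis by blast
qed

text \<open>The roots of \<open>z\<close> eventually stay below some \<open>D < c\<close>. If the
  lower limit were at least \<open>c\<close>, then \<open>a\<close> would outgrow
  \<open>E^(2^(n+1))\<close> for some \<open>E > D\<close>, making its tails smaller than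
  \<open>1 / z n\<close>, against the assumed lower bound on the tails.\<close>

lemma Sylvester_gap_forces_smaller_root:
  fixes a z w :: "nat \<Rightarrow> nat"
  assumes sums: "(\<lambda>n. 1 / real (a n)) sums s"
    and z: "\<And>n. n \<ge> N \<Longrightarrow> z n > 0" "\<And>n. n \<ge> N \<Longrightarrow> z (Suc n) = z n * (z n + 1)"
    and tail: "\<And>n. n \<ge> N \<Longrightarrow> 1 / real (z n) \<le> s - (\<Sum>i<n. 1 / real (a i))"
    and k: "k \<ge> N" "z k < b" and c: "real b powr (1 / 2 ^ Suc k) \<le> c"
  shows "liminf (\<lambda>n. ereal (real (a n) powr (1 / 2 ^ Suc n))) < ereal c"
proof (rule ccontr)
  assume "\<not> ?thesis"
  then have liminf: "ereal c \<le> liminf (\<lambda>n. ereal (real (a n) powr (1 / 2 ^ Suc n)))"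
    by simp
  \<comment> \<open>At index \<open>k\<close> itself, \<open>z k + 1 \<le> b\<close> gives only a
    weak inequality of roots. One step later it is strict, because
    \<open>z (z + 1) + 1 < (z + 1)^2\<close> for positive \<open>z\<close>.\<close>
  define D where "D = real (z (Suc k) + 1) powr (1 / 2 ^ Suc (Suc k))"
  have "1 \<le> D" unfolding D_def by (intro ge_one_powr_ge_zero) auto
  have "real (z (Suc k) + 1) < real (z k + 1) ^ 2"
    using z[OF k(1)] by (simp add: power2_eq_square algebra_simps)
  also have "\<dots> \<le> real b ^ 2" using k(2) by (intro power_mono) auto
  finally have "D < (real b ^ 2) powr (1 / 2 ^ Suc (Suc k))"
    unfolding D_def by (intro powr_less_mono2) auto
  also have "\<dots> = real b powr (1 / 2 ^ Suc k)"
    using k(2) by (intro powr_inverse_two_power_Suc[symmetric]) simp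
  finally have "D < c" using c by simp
  \<comment> \<open>Any value strictly between works: \<open>E < c\<close> makes \<open>E\<close> an
    eventual lower bound for the roots of \<open>a\<close>, and \<open>D < E\<close> leaves room for
    the gap between powers.\<close>
  define E where "E = (D + c) / 2"
  have E: "D < E" "E < c" using \<open>D < c\<close> by (auto simp: E_def)
  have "\<forall>\<^sub>F n in sequentially. ereal E < ereal (real (a n) powr (1 / 2 ^ Suc n))"
    by (intro less_LiminfD less_le_trans[OF _ liminf]) (simp add: E(2))
  then obtain n1 where n1: "\<And>n. n \<ge> n1 \<Longrightarrow> E < real (a n) powr (1 / 2 ^ Suc n)"
    by (auto simp: eventually_sequentially)
  have a_ge: "E ^ (2 ^ Suc n) \<le> real (a n)" if "n \<ge> n1" for n
  proof -
    have "E ^ (2 ^ Suc n) \<le> (real (a n) powr (1 / 2 ^ Suc n)) ^ (2 ^ Suc n)"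
      using n1[OF that] E(1) \<open>1 \<le> D\<close> by (intro power_mono) auto
    also have "\<dots> \<le> real (a n)"
      by (cases "a n = 0") (simp_all add: powr_power power_0_left)
    finally show ?thesis .
  qed
  obtain j0 where j0: "\<And>j. j \<ge> j0 \<Longrightarrow> D ^ (2 ^ Suc j) + 1 < E ^ (2 ^ Suc j)"
    using power_gap_unbounded[OF \<open>1 \<le> D\<close> E(1)] by blast
  define j where "j = n1 + j0 + Suc k"
  have j: "j \<ge> n1" "j \<ge> j0" "j \<ge> Suc k" "j \<ge> N" using k(1) by (auto simp: j_def)
  have "real (z j + 1) powr (1 / 2 ^ Suc j) \<le> D"
    unfolding D_def using j k(1) by (intro Sylvester_upper_root_le[where w = z and N = N, OF z(2)]) auto
  then have "(real (z j + 1) powr (1 / 2 ^ Suc j)) ^ (2 ^ Suc j) \<le> D ^ (2 ^ Suc j)"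
    by (intro power_mono) auto
  then have zD: "real (z j) < D ^ (2 ^ Suc j)"
    by (simp add: powr_power)
  have "1 / real (z j) \<le> 1 / (E ^ (2 ^ Suc j) - 1)"
    using tail[OF j(4)] doubly_exponential_tail_bound[OF sums, of E j] a_ge j(1) E(1) \<open>1 \<le> D\<close>
    by force
  moreover have "E ^ (2 ^ Suc j) - 1 > real (z j)" using zD j0[OF j(2)] by linarith
  then have "1 / (E ^ (2 ^ Suc j) - 1) < 1 / real (z j)"
    using z(1)[OF j(4)] by (intro divide_strict_left_mono) (auto intro!: mult_pos_pos)
  ultimately show False by simp
qed

section \<open>Comparison of \<open>a\<close> with the best underapproximation
  \<open>u\<close>\<close>

text \<open>Pigeonhole: if \<open>a i < u i\<close>, then the \<open>i + 1\<close> distinct values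
  \<open>a 0, ..., a i\<close> would all lie among the at most \<open>i\<close> values
  \<open>u 0, ..., u (i - 1)\<close>.\<close>

lemma strict_mono_range_subset_ge:
  fixes a u :: "nat \<Rightarrow> nat"
  assumes "strict_mono a" and "mono u" and "range a \<subseteq> range u"
  shows "u i \<le> a i"
proof (rule ccontr)
  assume *: "\<not> u i \<le> a i"
  have "a ` {..i} \<subseteq> u ` {..<i}"
  proof
    fix y assume "y \<in> a ` {..i}"
    then obtain l where l: "l \<le> i" "y = a l" by auto
    obtain j where j: "y = u j" using assms(3) l(2) by auto
    have "y < u i"
      using l strict_mono_less_eq[OF assms(1), of l i] * by simp
    then have "j < i" using j monoD[OF assms(2), of i j] by (metis not_le)
    then show "y \<in> u ` {..<i}" using j by auto
  qed
  then have "card (a ` {..i}) \<le> card (u ` {..<i})" by (intro card_mono) auto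
  also have "\<dots> \<le> i" using card_image_le[of "{..<i}" u] by simp
  also have "card (a ` {..i}) = Suc i"
    using strict_mono_imp_inj_on[OF assms(1)] by (simp add: card_image)
  finally show False by simp
qed

theorem theorem1p9:
  fixes \<alpha> :: real and u a :: "nat \<Rightarrow> nat"
  assumes eventually_greedy:
      "\<forall>\<theta>::real. \<theta> \<in> \<rat> \<and> 0 < \<theta> \<and> \<theta> \<le> 1 \<longrightarrow>
         (\<exists>n0::nat. \<forall>n\<ge>n0 + 1.
            R n \<theta> = R n0 \<theta> + R (n - n0) (\<theta> - R n0 \<theta>) \<and>
            best_underapprox (n - n0) (\<theta> - R n0 \<theta>)
              (greedy_underapprox (n - n0) (\<theta> - R n0 \<theta>)))"
    and "\<alpha> \<in> \<rat>" and "0 < \<alpha>" and "\<alpha> \<le> 1"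
    and "\<forall>m\<ge>1. \<exists>!xs. best_underapprox m \<alpha> xs"
    and "best_underapprox_seq \<alpha> u"
    and "strict_mono a" and "\<forall>n. a n > 0"
    and "(\<lambda>n. 1 / real (a n)) sums \<alpha>"
    and "a \<noteq> u"
  shows "convergent (\<lambda>n. real (u n) powr (1 / 2 ^ Suc n)) \<and>
         liminf (\<lambda>n. ereal (real (a n) powr (1 / 2 ^ Suc n)))
           < ereal (lim (\<lambda>n. real (u n) powr (1 / 2 ^ Suc n)))"
proof -
  have sylv: "\<exists>N w. \<forall>n\<ge>N. w n > (0::nat) \<and> \<theta> - R n \<theta> = 1 / real (w n) \<and>
      w (Suc n) = w n * (w n + 1)" if \<theta>: "\<theta> \<in> \<rat>" "0 < \<theta>" "\<theta> \<le> 1" for \<theta>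
  proof -
    from eventually_greedy \<theta> obtain n0 where "\<forall>n\<ge>n0 + 1.
            R n \<theta> = R n0 \<theta> + R (n - n0) (\<theta> - R n0 \<theta>) \<and>
            best_underapprox (n - n0) (\<theta> - R n0 \<theta>)
              (greedy_underapprox (n - n0) (\<theta> - R n0 \<theta>))"
      by blast
    with \<theta> show ?thesis by (intro R_remainder_eventually_Sylvester[of \<theta> n0]) blast+
  qed
  obtain N w where Nw: "\<And>n. n \<ge> N \<Longrightarrow> w n > (0::nat)"
      "\<And>n. n \<ge> N \<Longrightarrow> \<alpha> - R n \<alpha> = 1 / real (w n)"
      "\<And>n. n \<ge> N \<Longrightarrow> w (Suc n) = w n * (w n + 1)"
    using sylv[OF assms(2-4)] by metis

  have u_best: "best_underapprox m \<alpha> (map u [0..<m])" for m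
  proof (cases "m \<ge> 1")
    case False
    then have "m = 0" by simp
    then show ?thesis using \<open>0 < \<alpha>\<close>
      by (auto simp: best_underapprox_def underapprox_def egyptian_sum_def)
  qed (use assms(6) in \<open>auto simp: best_underapprox_seq_def\<close>)
  have R_u: "R m \<alpha> = (\<Sum>i<m. 1 / real (u i))" for m
    using R_eqI[OF u_best[of m]] by (simp add: egyptian_sum_map_upt atLeast0LessThan)
  have u_pos: "u n > 0" for n
    using u_best[of "Suc n"] by (auto simp: best_underapprox_def underapprox_def)
  have "mono u"
  proof (rule mono_iff_le_Suc[THEN iffD2], rule allI)
    fix n
    have "sorted (map u [0..<Suc (Suc n)])"
      using u_best[of "Suc (Suc n)"] by (auto simp: best_underapprox_def underapprox_def)
    then show "u n \<le> u (Suc n)" by (simp add: sorted_append)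
  qed
  \<comment> \<open>The term \<open>1 / u n\<close> is the difference of consecutive remainders,
    \<open>1 / w n - 1 / (w n (w n + 1)) = 1 / (w n + 1)\<close>.\<close>
  have u_w: "u n = w n + 1" if "n \<ge> N" for n
  proof -
    have "1 / real (u n) = 1 / real (w n) - 1 / real (w (Suc n))"
      using R_u[of n] R_u[of "Suc n"] Nw(2)[of n] Nw(2)[of "Suc n"] that by simp
    also have "\<dots> = 1 / real (w n + 1)"
    proof -
      have "real (w (Suc n)) = real (w n) * (real (w n) + 1)" "real (w n) > 0"
        using Nw(1)[OF that] Nw(3)[OF that] by (simp_all add: distrib_left)
      then show ?thesis by (simp add: divide_simps)
    qed
    finally have "real (u n) = real (w n + 1)" by (simp only: divide_cancel_left) simp
    then show ?thesis by (simp only: of_nat_eq_iff)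
  qed
  obtain c where c: "(\<lambda>n. real (w n + 1) powr (1 / 2 ^ Suc n)) \<longlonglongrightarrow> c"
    and c_ge: "\<And>m. m \<ge> N \<Longrightarrow> real (w m) powr (1 / 2 ^ Suc m) \<le> c"
    using Sylvester_root_limit[where w = w and N = N, OF Nw(3) Nw(1)] by blast
  have "\<forall>\<^sub>F n in sequentially. real (w n + 1) powr (1 / 2 ^ Suc n) = real (u n) powr (1 / 2 ^ Suc n)"
    using eventually_ge_at_top[of N] by eventually_elim (simp add: u_w)
  then have lim_u: "(\<lambda>n. real (u n) powr (1 / 2 ^ Suc n)) \<longlonglongrightarrow> c"
    using c by (rule Lim_transform_eventually[rotated])

  have "liminf (\<lambda>n. ereal (real (a n) powr (1 / 2 ^ Suc n))) < ereal c"
  proof (rule ccontr)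
    assume contr: "\<not> ?thesis"
    have sum_a_lt: "(\<Sum>i<m. 1 / real (a i)) < \<alpha>" for m
      using sum_less_suminf[of "\<lambda>n. 1 / real (a n)" m] assms(8,9) by (simp add: sums_iff)
    have a_in_range: "a ` {..<m} \<subseteq> range u" for m
    proof -
      define \<theta> where "\<theta> = \<alpha> - (\<Sum>i<m. 1 / real (a i))"
      have \<theta>: "\<theta> \<in> \<rat>" "0 < \<theta>" "\<theta> \<le> 1"
        using sum_a_lt[of m] assms(2,4) sum_nonneg[of "{..<m}" "\<lambda>i. 1 / real (a i)"]
        by (auto simp: \<theta>_def intro!: Rats_diff Rats_sum)
      obtain N' z where z: "\<And>n. n \<ge> N' \<Longrightarrow> z n > (0::nat)"
          "\<And>n. n \<ge> N' \<Longrightarrow> \<theta> - R n \<theta> = 1 / real (z n)"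
          "\<And>n. n \<ge> N' \<Longrightarrow> z (Suc n) = z n * (z n + 1)"
        using sylv[OF \<theta>] by metis
      \<comment> \<open>The \<open>n\<close> terms of \<open>a\<close> following the first
        \<open>m\<close> form an underapproximation of \<open>\<theta>\<close>, so what they leave
        over is at least the optimal remainder \<open>1 / z n\<close>.\<close>
      have tail: "1 / real (z n) \<le> \<alpha> - (\<Sum>i<n + m. 1 / real (a i))" if "n \<ge> N'" for n
      proof -
        let ?l = "map a [m..<n + m]"
        have split: "(\<Sum>i<n + m. 1 / real (a i)) = (\<Sum>i<m. 1 / real (a i)) + egyptian_sum ?l"
          using sum.atLeastLessThan_concat[of 0 m "n + m" "\<lambda>i. 1 / real (a i)"]
          by (simp add: egyptian_sum_map_upt atLeast0LessThan)
        have "sorted ?l"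
          using strict_mono_mono[OF assms(7)] by (auto simp: sorted_iff_nth_mono intro: monoD)
        then have "underapprox n \<theta> ?l"
          using assms(8) sum_a_lt[of "n + m"] split by (auto simp: underapprox_def \<theta>_def)
        then have "egyptian_sum ?l \<le> R n \<theta>" by (rule R_upper[OF \<theta>(2)])
        then show ?thesis using z(2)[OF that] split by (simp add: \<theta>_def)
      qed
      \<comment> \<open>Large enough for both recursions; the extra 1 keeps \<open>k + m\<close>
        positive when \<open>m = 0\<close>, as uniqueness is assumed only for positive
        lengths.\<close>
      define k where "k = N + N' + 1"
      have k: "k \<ge> N'" "k + m \<ge> N" "k + m \<ge> 1" by (auto simp: k_def)
      \<comment> \<open>Otherwise the gap argument applies to \<open>a\<close>, with
        \<open>z\<close> shifted by \<open>m\<close> and \<open>b = w (k + m)\<close>, whose root is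
        at most \<open>c\<close> by \<open>c_ge\<close>; this contradicts
        \<open>contr\<close>.\<close>
      have "w (k + m) \<le> z k"
      proof (rule ccontr)
        assume "\<not> w (k + m) \<le> z k"
        moreover have "1 / real (z (n - m)) \<le> \<alpha> - (\<Sum>i<n. 1 / real (a i))"
          if "n \<ge> N' + m" for n
          using tail[of "n - m"] that by simp
        ultimately have "liminf (\<lambda>n. ereal (real (a n) powr (1 / 2 ^ Suc n))) < ereal c"
          using z(1,3) k c_ge[of "k + m"]
          by (intro Sylvester_gap_forces_smaller_root[OF assms(9),
                of "N' + m" "\<lambda>n. z (n - m)" "k + m" "w (k + m)"])
            (auto simp: Suc_diff_le simp del: power_Suc)
        then show False using contr by simp
      qed
      obtain ys where ys: "underapprox k \<theta> ys" "egyptian_sum ys = R k \<theta>"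
        using R_attained[OF \<theta>(2)] .
      \<comment> \<open>Completing the first \<open>m\<close> terms of \<open>a\<close> by an
        optimal list for \<open>\<theta>\<close> leaves the remainder \<open>1 / z k\<close>. It is
        positive and at most \<open>1 / w (k + m)\<close>, the smallest possible for
        \<open>k + m\<close> terms, so \<open>xs\<close> is a best list.\<close>
      define xs where "xs = sort (map a [0..<m] @ ys)"
      have sum_xs: "egyptian_sum xs = \<alpha> - 1 / real (z k)"
        using z(2)[OF k(1)] ys(2)
        by (simp add: xs_def egyptian_sum_append egyptian_sum_map_upt atLeast0LessThan \<theta>_def
            del: sort_append)
      have "underapprox (k + m) \<alpha> xs"
        using underapprox_sort[of "map a [0..<m] @ ys" \<alpha>] ys assms(8) sum_xs z(1)[OF k(1)]
        by (auto simp: xs_def underapprox_def add.commute)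
      moreover have "R (k + m) \<alpha> \<le> egyptian_sum xs"
      proof -
        have "1 / real (z k) \<le> 1 / real (w (k + m))"
          using \<open>w (k + m) \<le> z k\<close> Nw(1)[OF k(2)] by (intro divide_left_mono) auto
        then show ?thesis using Nw(2)[OF k(2)] sum_xs by simp
      qed
      ultimately have "best_underapprox (k + m) \<alpha> xs"
        using R_upper[OF \<open>0 < \<alpha>\<close>] by (force simp: best_underapprox_def)
      then have "xs = map u [0..<k + m]"
        using assms(5) k(3) u_best[of "k + m"] by blast
      then have "set (map a [0..<m] @ ys) = set (map u [0..<k + m])"
        by (metis set_sort xs_def)
      then have "a ` {..<m} \<union> set ys = u ` {..<k + m}"
        by (simp add: atLeast0LessThan)
      then show ?thesis by blast
    qed
    then have "range a \<subseteq> range u" by blast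
    then have u_le_a: "u i \<le> a i" for i
      by (rule strict_mono_range_subset_ge[OF assms(7) \<open>mono u\<close>])
    obtain i where "a i \<noteq> u i" using \<open>a \<noteq> u\<close> by blast
    with u_le_a[of i] have "u i < a i" by simp
    \<comment> \<open>All differences \<open>d n\<close> are nonnegative and the partial sums of
      \<open>u\<close> stay below \<open>\<alpha>\<close>. One positive \<open>d i\<close> therefore
      keeps the later partial sums of \<open>a\<close> at distance at least \<open>d i\<close> below
      \<open>\<alpha>\<close>, so they cannot converge to \<open>\<alpha>\<close>.\<close>
    define d where "d n = 1 / real (u n) - 1 / real (a n)" for n
    have d_nonneg: "d n \<ge> 0" for n
      using u_le_a[of n] u_pos[of n] by (auto simp: d_def intro!: divide_left_mono)
    have "d i > 0"
      using \<open>u i < a i\<close> u_pos[of i] by (auto simp: d_def intro!: divide_strict_left_mono)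
    have "(\<Sum>n<m. 1 / real (a n)) \<le> \<alpha> - d i" if "m > i" for m
    proof -
      have "d i \<le> (\<Sum>n<m. d n)" using that d_nonneg by (intro member_le_sum) auto
      moreover have "(\<Sum>n<m. 1 / real (u n)) < \<alpha>"
        using u_best[of m] by (simp add: best_underapprox_def underapprox_def
            egyptian_sum_map_upt atLeast0LessThan)
      ultimately show ?thesis by (simp add: d_def sum_subtractf)
    qed
    then have "\<alpha> \<le> \<alpha> - d i"
      using assms(9) by (intro LIMSEQ_le_const2[of _ \<alpha>]) (auto simp: sums_def intro!: exI[of _ "Suc i"])
    with \<open>d i > 0\<close> show False by simp
  qed
  then show ?thesis
    using lim_u limI[OF lim_u] by (auto simp: convergent_def)
qed

end
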